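(* Let $G$ be a finite group, $\omega\colon G^3\to\mathbb C^\times$ a normalized 3-cocycle, and let $V,W$ be simple objects of $\mathcal Z(\mathrm{Vec}_G^\omega)$ corresponding to pairs $(g,\chi_1)$ and $(h,\chi_2)$. Then $$S_{(g,\chi_1),(h,\chi_2)}=|\overline h|\sum_{\substack{x\in\overline g\\ [x,h]=1}}\chi_1^x(h)\,\chi_2(x)=\frac{|\overline h|}{|C_G(g)|}\sum_{\substack{p\in G\\ [p\triangleright g,h]=1}}\alpha_g(h,p)\,\alpha_g(p,p^{-1}\triangleright h)^{-1}\,\chi_1(p^{-1}\triangleright h)\,\chi_2(p\triangleright g).$$
   Context: **Notation.** $g\triangleright h=ghg^{-1}$, $[g,h]=ghg^{-1}h^{-1}$, $\overline g$ is the conjugacy class of $g$, $C_G(g)$ its centralizer. **The category.** $\mathrm{Vec}_G^\omega$ is the category of finite-dimensional $G$-graded vector spaces with associativity isomorphism $\Phi\colon U\otimes(V\otimes W)\to(U\otimes V)\otimes W$, $u\otimes(v\otimes w)\mapsto\omega(|u|,|v|,|w|)(u\otimes v)\otimes w$ on homogeneous elements ($|u|$ is the degree of $u$). $\mathcal Z(\mathrm{Vec}_G^\omega)$ is the (right) Drinfeld center: objects are graded spaces $W$ with linear maps $g\triangleright\colon W\to W$ ($g\in G$) satisfying $|g\triangleright w|=g\triangleright|w|$, $e\triangleright w=w$, $g\triangleright(h\triangleright w)=\alpha_{|w|}(g,h)\,(gh)\triangleright w$, where $\alpha_g(x,y)=\omega(x,y,g)\,\omega(x,y\triangleright g,y)^{-1}\,\omega((xy)\triangleright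 g,x,y)$; the braiding is $\sigma_{V,W}(v\otimes w)=|v|\triangleright w\otimes v$. It is a modular category with the spherical structure for which pivotal traces are ordinary traces of linear maps. Simple objects are parametrized by pairs $(g,\chi)$, with $g$ running over representatives of conjugacy classes and $\chi$ an irreducible $\alpha_g$-projective character of $C_G(g)$: the simple $V$ has support $\overline g$, and $\chi$ is the character of $C_G(g)$ acting on the homogeneous component $V_g$. **Transported characters.** If $V$ corresponds to $(g,\chi)$ and $x\in\overline g$, then $\chi^x$ is the projective character of $C_G(x)$ acting on $V_x$. **$S$-matrix.** $S_{V,W}=\mathrm{tr}(\sigma_{W,V}\sigma_{V,W})$ (unnormalized), the trace of the double braiding on $V\otimes W$. *)

theory Defs
  imports Complex_Main "HOL-Library.FuncSet" "HOL-Library.Function_Algebras" "HOL-Algebra.Group"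
begin

section \<open>Groups and cocycles\<close>

definition conjugate :: "('g, 'm) monoid_scheme \<Rightarrow> 'g \<Rightarrow> 'g \<Rightarrow> 'g"  (infixr \<open>\<triangleright>\<index>\<close> 75)
  where "p \<triangleright>\<^bsub>G\<^esub> g = p \<otimes>\<^bsub>G\<^esub> g \<otimes>\<^bsub>G\<^esub> inv\<^bsub>G\<^esub> p"

definition commutator :: "('g, 'm) monoid_scheme \<Rightarrow> 'g \<Rightarrow> 'g \<Rightarrow> 'g"
  where "commutator G g h = g \<otimes>\<^bsub>G\<^esub> h \<otimes>\<^bsub>G\<^esub> inv\<^bsub>G\<^esub> g \<otimes>\<^bsub>G\<^esub> inv\<^bsub>G\<^esub> h"

definition conj_class :: "('g, 'm) monoid_scheme \<Rightarrow> 'g \<Rightarrow> 'g set"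
  where "conj_class G g = {p \<triangleright>\<^bsub>G\<^esub> g | p. p \<in> carrier G}"

definition centralizer :: "('g, 'm) monoid_scheme \<Rightarrow> 'g \<Rightarrow> 'g set"
  where "centralizer G g = {c \<in> carrier G. c \<otimes>\<^bsub>G\<^esub> g = g \<otimes>\<^bsub>G\<^esub> c}"

text \<open>The cocycle identity is the pentagon axiom for the associator
  \<open>u \<otimes> (v \<otimes> w) \<mapsto> \<omega>(|u|,|v|,|w|) (u \<otimes> v) \<otimes> w\<close>.\<close>

definition normalized_3_cocycle ::
  "('g, 'm) monoid_scheme \<Rightarrow> ('g \<Rightarrow> 'g \<Rightarrow> 'g \<Rightarrow> complex) \<Rightarrow> bool"
  where "normalized_3_cocycle G \<omega> \<longleftrightarrow>
    (\<forall>a\<in>carrier G. \<forall>b\<in>carrier G. \<forall>c\<in>carrier G. \<omega> a b c \<noteq> 0) \<and>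
    (\<forall>a\<in>carrier G. \<forall>b\<in>carrier G. \<forall>c\<in>carrier G. \<forall>d\<in>carrier G.
       \<omega> b c d * \<omega> a (b \<otimes>\<^bsub>G\<^esub> c) d * \<omega> a b c
         = \<omega> (a \<otimes>\<^bsub>G\<^esub> b) c d * \<omega> a b (c \<otimes>\<^bsub>G\<^esub> d)) \<and>
    (\<forall>a\<in>carrier G. \<forall>b\<in>carrier G.
       \<omega> \<one>\<^bsub>G\<^esub> a b = 1 \<and> \<omega> a \<one>\<^bsub>G\<^esub> b = 1 \<and> \<omega> a b \<one>\<^bsub>G\<^esub> = 1)"

text \<open>\<open>proj_cocycle G \<omega> g x y\<close> is \<open>\<alpha>\<^sub>g(x,y)\<close>.\<close>

definition proj_cocycle ::
  "('g, 'm) monoid_scheme \<Rightarrow> ('g \<Rightarrow> 'g \<Rightarrow> 'g \<Rightarrow> complex) \<Rightarrow> 'g \<Rightarrow> 'g \<Rightarrow> 'g \<Rightarrow> complex"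
  where "proj_cocycle G \<omega> g x y =
    \<omega> x y g * inverse (\<omega> x (y \<triangleright>\<^bsub>G\<^esub> g) y) * \<omega> ((x \<otimes>\<^bsub>G\<^esub> y) \<triangleright>\<^bsub>G\<^esub> g) x y"


section \<open>Traces\<close>

text \<open>The trace of \<open>f\<close> on a finite-dimensional \<open>f\<close>-invariant subspace \<open>S\<close>; see \<open>trace_on_eq\<close>
  for independence of the basis.\<close>

definition trace_on ::
  "(complex \<Rightarrow> 'v \<Rightarrow> 'v) \<Rightarrow> 'v::ab_group_add set \<Rightarrow> ('v \<Rightarrow> 'v) \<Rightarrow> complex"
  where "trace_on s S f =
    (let B = (SOME B. \<not> module.dependent s B \<and> module.span s B = S)
     in \<Sum>b\<in>B. module.representation s B (f b) b)"

lemma trace_on_eq: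
  fixes s :: "complex \<Rightarrow> 'v::ab_group_add \<Rightarrow> 'v"
  assumes lin: "Vector_Spaces.linear s s f"
    and B: "finite B" "\<not> module.dependent s B" "module.span s B = S"
    and inv: "f ` S \<subseteq> S"
  shows "trace_on s S f = (\<Sum>b\<in>B. module.representation s B (f b) b)"
proof -
  interpret f: Vector_Spaces.linear s s f by fact
  define C where "C = (SOME B. \<not> f.vs1.dependent B \<and> f.vs1.span B = S)"
  have "\<not> f.vs1.dependent C \<and> f.vs1.span C = S"
    unfolding C_def by (rule someI[of _ B]) (use B in auto)
  then have C: "\<not> f.vs1.dependent C" "f.vs1.span C = S" by auto
  have finC: "finite C"
    using f.vs1.independent_span_bound[OF B(1) C(1)] C(2) B(3) f.vs1.span_superset by auto
  have BS: "b \<in> S" if "b \<in> B" for b using that B(3) f.vs1.span_base by auto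
  have CS: "c \<in> S" if "c \<in> C" for c using that C(2) f.vs1.span_base by auto
  have fS: "f v \<in> S" if "v \<in> S" for v using inv that by auto
  have "(\<Sum>b\<in>B. f.vs1.representation B (f b) b)
      = (\<Sum>b\<in>B. \<Sum>c\<in>C. f.vs1.representation C b c * f.vs1.representation B (f c) b)"
  proof (rule sum.cong[OF refl])
    fix b assume b: "b \<in> B"
    have "f b = f (\<Sum>c\<in>C. s (f.vs1.representation C b c) c)"
      using f.vs1.sum_representation_eq[OF C(1) _ finC order_refl, of b] C(2) BS[OF b] by simp
    also have "\<dots> = (\<Sum>c\<in>C. s (f.vs1.representation C b c) (f c))"
      by (simp add: f.sum f.scale)
    finally have "f.vs1.representation B (f b) b
        = (\<Sum>c\<in>C. f.vs1.representation B (s (f.vs1.representation C b c) (f c)) b)"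
      by (simp add: f.vs1.representation_sum[OF B(2)] B(3) f.vs1.span_scale CS fS f.vs1.subspace_scale
          f.vs1.subspace_span[of B, unfolded B(3)])
    also have "\<dots> = (\<Sum>c\<in>C. f.vs1.representation C b c * f.vs1.representation B (f c) b)"
      by (rule sum.cong) (simp_all add: f.vs1.representation_scale[OF B(2)] B(3) CS fS)
    finally show "f.vs1.representation B (f b) b
        = (\<Sum>c\<in>C. f.vs1.representation C b c * f.vs1.representation B (f c) b)" .
  qed
  also have "\<dots> = (\<Sum>c\<in>C. \<Sum>b\<in>B. f.vs1.representation B (f c) b * f.vs1.representation C b c)"
    by (subst sum.swap) (simp add: mult.commute)
  also have "\<dots> = (\<Sum>c\<in>C. f.vs1.representation C (f c) c)"
  proof (rule sum.cong[OF refl])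
    fix c assume c: "c \<in> C"
    have "f c = (\<Sum>b\<in>B. s (f.vs1.representation B (f c) b) b)"
      using f.vs1.sum_representation_eq[OF B(2) _ B(1) order_refl, of "f c"] B(3) CS[OF c] fS by simp
    then have "f.vs1.representation C (f c) c
        = f.vs1.representation C (\<Sum>b\<in>B. s (f.vs1.representation B (f c) b) b) c" by simp
    also have "\<dots> = (\<Sum>b\<in>B. f.vs1.representation C (s (f.vs1.representation B (f c) b) b) c)"
      by (simp add: f.vs1.representation_sum[OF C(1)] C(2) BS f.vs1.subspace_scale
          f.vs1.subspace_span[of C, unfolded C(2)])
    also have "\<dots> = (\<Sum>b\<in>B. f.vs1.representation B (f c) b * f.vs1.representation C b c)"
      by (rule sum.cong) (simp_all add: f.vs1.representation_scale[OF C(1)] C(2) BS)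
    finally show "(\<Sum>b\<in>B. f.vs1.representation B (f c) b * f.vs1.representation C b c)
        = f.vs1.representation C (f c) c" by simp
  qed
  finally show ?thesis
    unfolding trace_on_def Let_def C_def by simp
qed


section \<open>Tensor products\<close>

definition bilinear_map ::
  "(complex \<Rightarrow> 'v \<Rightarrow> 'v::ab_group_add) \<Rightarrow> (complex \<Rightarrow> 'w \<Rightarrow> 'w::ab_group_add) \<Rightarrow>
   (complex \<Rightarrow> 'u \<Rightarrow> 'u::ab_group_add) \<Rightarrow> ('v \<Rightarrow> 'w \<Rightarrow> 'u) \<Rightarrow> bool"
  where "bilinear_map s t r \<beta> \<longleftrightarrow>
    (\<forall>v. Vector_Spaces.linear t r (\<beta> v)) \<and> (\<forall>w. Vector_Spaces.linear s r (\<lambda>v. \<beta> v w))"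

text \<open>The tensor product of two vector spaces is realized inside the space of functionals on
  bilinear forms, \<open>v \<otimes> w\<close> being evaluation at \<open>(v, w)\<close>.  The universal property is
  \<open>tensor_universal\<close> below.\<close>

type_synonym ('v, 'w) tensor = "('v \<Rightarrow> 'w \<Rightarrow> complex) \<Rightarrow> complex"

definition tensor_scale :: "complex \<Rightarrow> ('v, 'w) tensor \<Rightarrow> ('v, 'w) tensor"
  where "tensor_scale c T = (\<lambda>\<beta>. c * T \<beta>)"

definition tensor ::
  "(complex \<Rightarrow> 'v \<Rightarrow> 'v::ab_group_add) \<Rightarrow> (complex \<Rightarrow> 'w \<Rightarrow> 'w::ab_group_add) \<Rightarrow>
   'v \<Rightarrow> 'w \<Rightarrow> ('v, 'w) tensor"
  where "tensor s t v w = (\<lambda>\<beta>. if bilinear_map s t (*) \<beta> then \<beta> v w else 0)"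

definition tensor_space ::
  "(complex \<Rightarrow> 'v \<Rightarrow> 'v::ab_group_add) \<Rightarrow> (complex \<Rightarrow> 'w \<Rightarrow> 'w::ab_group_add) \<Rightarrow>
   ('v, 'w) tensor set"
  where "tensor_space s t = module.span tensor_scale {tensor s t v w | v w. True}"

lemma vector_space_tensor_scale: "vector_space tensor_scale"
  by unfold_locales (auto simp: tensor_scale_def algebra_simps fun_eq_iff)

lemma vector_space_complex: "vector_space ((*) :: complex \<Rightarrow> complex \<Rightarrow> complex)"
  by unfold_locales (auto simp: algebra_simps)

lemma linearI:
  assumes "vector_space s" "vector_space t"
    and "\<And>x y. f (x + y) = f x + f y" "\<And>c x. f (s c x) = t c (f x)"
  shows "Vector_Spaces.linear s t f"
  using assms by (simp add: Vector_Spaces.linear_iff)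

lemma sum_fun_apply: "(\<Sum>i\<in>I. f i) x = (\<Sum>i\<in>I. f i x)"
  by (induction I rule: infinite_finite_induct) simp_all

lemma bilinear_tensor:
  assumes "vector_space s" "vector_space t"
  shows "bilinear_map s t tensor_scale (tensor s t)"
proof -
  have lin: "\<beta> v (w + w') = \<beta> v w + \<beta> v w'" "\<beta> (v + v') w = \<beta> v w + \<beta> v' w"
    "\<beta> v (t c w) = c * \<beta> v w" "\<beta> (s c v) w = c * \<beta> v w"
    if "bilinear_map s t (*) \<beta>" for \<beta> v v' w w' c
    using that by (simp_all add: bilinear_map_def Vector_Spaces.linear_iff)
  have "Vector_Spaces.linear t tensor_scale (tensor s t v)" for v
    by (rule linearI) (auto simp: assms vector_space_tensor_scale tensor_def tensor_scale_def
        fun_eq_iff lin)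
  moreover have "Vector_Spaces.linear s tensor_scale (\<lambda>v. tensor s t v w)" for w
    by (rule linearI) (auto simp: assms vector_space_tensor_scale tensor_def tensor_scale_def
        fun_eq_iff lin)
  ultimately show ?thesis
    by (simp add: bilinear_map_def)
qed

lemma tensor_basis:
  fixes s :: "complex \<Rightarrow> 'v::ab_group_add \<Rightarrow> 'v" and t :: "complex \<Rightarrow> 'w::ab_group_add \<Rightarrow> 'w"
  assumes "vector_space s" "vector_space t"
    and B: "\<not> module.dependent s B" "module.span s B = UNIV"
    and C: "\<not> module.dependent t C" "module.span t C = UNIV"
  shows "inj_on (\<lambda>(b, c). tensor s t b c) (B \<times> C)"
    and "\<not> module.dependent tensor_scale ((\<lambda>(b, c). tensor s t b c) ` (B \<times> C))"
proof -
  interpret S: vector_space s by fact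
  interpret T: vector_space t by fact
  interpret X: vector_space "tensor_scale :: complex \<Rightarrow> ('v, 'w) tensor \<Rightarrow> ('v, 'w) tensor"
    by (rule vector_space_tensor_scale)
  define \<delta> where "\<delta> b c = (\<lambda>v w. S.representation B v b * T.representation C w c)" for b c
  have bil: "bilinear_map s t (*) (\<delta> b c)" for b c
    unfolding bilinear_map_def \<delta>_def
    by (auto intro!: linearI assms(1,2) vector_space_complex
        simp: S.representation_add[OF B(1)] S.representation_scale[OF B(1)]
          T.representation_add[OF C(1)] T.representation_scale[OF C(1)] B(2) C(2) algebra_simps)
  have ev: "tensor s t b' c' (\<delta> b c) = (if b' = b \<and> c' = c then 1 else 0)"
    if "b' \<in> B" "c' \<in> C" for b b' c c'
    using that bil by (auto simp: tensor_def \<delta>_def S.representation_basis[OF B(1)]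
        T.representation_basis[OF C(1)])
  let ?f = "\<lambda>(b, c). tensor s t b c"
  show inj: "inj_on ?f (B \<times> C)"
  proof (rule inj_onI, clarify)
    fix b c b' c' assume *: "b \<in> B" "c \<in> C" "b' \<in> B" "c' \<in> C" "tensor s t b c = tensor s t b' c'"
    show "b = b' \<and> c = c'"
    proof (rule ccontr)
      assume "\<not> (b = b' \<and> c = c')"
      then have "tensor s t b' c' (\<delta> b c) = 0" using ev[OF *(3,4), of b c] by metis
      moreover have "tensor s t b c (\<delta> b c) = 1" using ev[OF *(1,2), of b c] by metis
      ultimately show False using *(5) by simp
    qed
  qed
  show "\<not> X.dependent (?f ` (B \<times> C))"
  proof
    assume "X.dependent (?f ` (B \<times> C))"
    then obtain A :: "('v, 'w) tensor set" and u :: "('v, 'w) tensor \<Rightarrow> complex" and x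
      where A: "finite A" "A \<subseteq> ?f ` (B \<times> C)"
        "(\<Sum>v\<in>A. tensor_scale (u v) v) = 0" and x: "x \<in> A" and ux: "u x \<noteq> 0"
      unfolding X.dependent_explicit by blast
    have img: "\<exists>b c. b \<in> B \<and> c \<in> C \<and> v = tensor s t b c" if "v \<in> A" for v
    proof -
      from that A(2) have "v \<in> ?f ` (B \<times> C)" by (rule rev_subsetD)
      then obtain z where z: "v = ?f z" "z \<in> B \<times> C" by (rule imageE)
      obtain b c where bc: "z = (b, c)" by (rule prod.exhaust)
      have "b \<in> B" "c \<in> C" "v = tensor s t b c"
        using z unfolding bc by (simp_all only: mem_Sigma_iff prod.case)
      then show ?thesis by blast
    qed
    obtain b c where bc: "b \<in> B" "c \<in> C" "x = tensor s t b c" using img[OF x] by blast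
    have "0 = (\<Sum>v\<in>A. tensor_scale (u v) v) (\<delta> b c)" by (simp only: A(3) zero_fun_apply)
    also have "\<dots> = (\<Sum>v\<in>A. u v * v (\<delta> b c))"
      by (simp only: sum_fun_apply tensor_scale_def)
    also have "\<dots> = (\<Sum>v\<in>A. if v = x then u x else 0)"
    proof (rule sum.cong[OF refl])
      fix v assume "v \<in> A"
      then obtain b' c' where v: "b' \<in> B" "c' \<in> C" "v = tensor s t b' c'" using img by blast
      have vx: "v = x \<longleftrightarrow> b' = b \<and> c' = c"
      proof
        assume "v = x"
        then have "?f (b', c') = ?f (b, c)" using v(3) bc(3) by (simp only: prod.case)
        from inj_onD[OF inj this] show "b' = b \<and> c' = c"
          by (simp only: v(1,2) bc(1,2) mem_Sigma_iff prod.inject)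
      next
        assume "b' = b \<and> c' = c"
        then show "v = x" using v(3) bc(3) by metis
      qed
      have "v (\<delta> b c) = (if b' = b \<and> c' = c then 1 else 0)"
        unfolding v(3) by (rule ev[OF v(1,2)])
      then show "u v * v (\<delta> b c) = (if v = x then u x else 0)"
        unfolding vx[symmetric] by simp
    qed
    also have "\<dots> = u x" using A(1) x by simp
    finally show False using ux by simp
  qed
qed

lemma bilinear_eqI:
  fixes s :: "complex \<Rightarrow> 'v::ab_group_add \<Rightarrow> 'v" and t :: "complex \<Rightarrow> 'w::ab_group_add \<Rightarrow> 'w"
  assumes "bilinear_map s t r \<beta>" "bilinear_map s t r \<gamma>"
    and B: "module.span s B = UNIV" and C: "module.span t C = UNIV"
    and eq: "\<And>b c. b \<in> B \<Longrightarrow> c \<in> C \<Longrightarrow> \<beta> b c = \<gamma> b c"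
  shows "\<beta> v w = \<gamma> v w"
proof -
  have lt: "Vector_Spaces.linear t r (\<beta> v)" "Vector_Spaces.linear t r (\<gamma> v)"
    and ls: "Vector_Spaces.linear s r (\<lambda>v. \<beta> v w)" "Vector_Spaces.linear s r (\<lambda>v. \<gamma> v w)" for v w
    using assms(1,2) by (auto simp: bilinear_map_def)
  interpret P: vector_space_pair t r
    using lt(1) by (auto simp: vector_space_pair_def Vector_Spaces.linear_iff)
  interpret Q: vector_space_pair s r
    using ls(1) by (auto simp: vector_space_pair_def Vector_Spaces.linear_iff)
  have 1: "\<beta> b w = \<gamma> b w" if "b \<in> B" for b w
    by (rule P.linear_eq_on[OF lt(1) lt(2), where B = C]) (use C eq that in auto)
  show ?thesis
    by (rule Q.linear_eq_on[OF ls(1) ls(2), where B = B]) (use B 1 in auto)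
qed

lemma linear_bilinear_compose:
  assumes F: "Vector_Spaces.linear r q F" and "bilinear_map s t r \<beta>"
  shows "bilinear_map s t q (\<lambda>v w. F (\<beta> v w))"
  using assms by (simp add: bilinear_map_def Vector_Spaces.linear_iff)

lemma tensor_universal:
  fixes s :: "complex \<Rightarrow> 'v::ab_group_add \<Rightarrow> 'v" and t :: "complex \<Rightarrow> 'w::ab_group_add \<Rightarrow> 'w"
    and r :: "complex \<Rightarrow> 'u::ab_group_add \<Rightarrow> 'u"
  assumes "vector_space s" "vector_space t" and \<beta>: "bilinear_map s t r \<beta>"
  shows "\<exists>F. Vector_Spaces.linear tensor_scale r F \<and> (\<forall>v w. F (tensor s t v w) = \<beta> v w)"
    and "\<lbrakk>Vector_Spaces.linear tensor_scale r F; Vector_Spaces.linear tensor_scale r F';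
          \<And>v w. F (tensor s t v w) = \<beta> v w; \<And>v w. F' (tensor s t v w) = \<beta> v w;
          T \<in> tensor_space s t\<rbrakk> \<Longrightarrow> F T = F' T"
proof -
  interpret S: vector_space s by fact
  interpret T: vector_space t by fact
  have "vector_space r"
    using \<beta> by (auto simp: bilinear_map_def Vector_Spaces.linear_iff)
  then interpret P: vector_space_pair tensor_scale r
    by (simp add: vector_space_pair_def vector_space_tensor_scale)
  show "F T = F' T" if "Vector_Spaces.linear tensor_scale r F"
    "Vector_Spaces.linear tensor_scale r F'"
    "\<And>v w. F (tensor s t v w) = \<beta> v w" "\<And>v w. F' (tensor s t v w) = \<beta> v w"
    "T \<in> tensor_space s t"
  proof (rule P.linear_eq_on[OF that(1,2)])
    show "T \<in> P.vs1.span {tensor s t v w | v w. True}"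
      using that(5) by (simp only: tensor_space_def)
    show "F b = F' b" if "b \<in> {tensor s t v w | v w. True}" for b
    proof -
      from that obtain v w where "b = tensor s t v w" by blast
      then show ?thesis by (simp only: \<open>\<And>v w. F (tensor s t v w) = \<beta> v w\<close> \<open>\<And>v w. F' (tensor s t v w) = \<beta> v w\<close>)
    qed
  qed
  obtain B where B0: "\<not> S.dependent B" "UNIV \<subseteq> S.span B"
    by (rule S.maximal_independent_subset[of UNIV])
  then have B: "\<not> S.dependent B" "S.span B = UNIV" by (auto intro: top_le)
  obtain C where C0: "\<not> T.dependent C" "UNIV \<subseteq> T.span C"
    by (rule T.maximal_independent_subset[of UNIV])
  then have C: "\<not> T.dependent C" "T.span C = UNIV" by (auto intro: top_le)
  note basis = tensor_basis[OF assms(1,2) B C]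
  let ?f = "\<lambda>(b, c). tensor s t b c"
  obtain F where F: "Vector_Spaces.linear tensor_scale r F"
    "\<forall>x\<in>?f ` (B \<times> C). F x = case_prod \<beta> (inv_into (B \<times> C) ?f x)"
    using P.linear_independent_extend[OF basis(2), of "\<lambda>x. case_prod \<beta> (inv_into (B \<times> C) ?f x)"]
    by (elim exE conjE) (rule that)
  have "F (tensor s t b c) = \<beta> b c" if "b \<in> B" "c \<in> C" for b c
  proof -
    have bc: "(b, c) \<in> B \<times> C" using that by simp
    from F(2) imageI[OF bc, of ?f]
    have "F (?f (b, c)) = case_prod \<beta> (inv_into (B \<times> C) ?f (?f (b, c)))" by (rule bspec)
    then show ?thesis unfolding inv_into_f_f[OF basis(1) bc] by (simp only: prod.case)
  qed
  then have "F (tensor s t v w) = \<beta> v w" for v w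
    by (rule bilinear_eqI[OF linear_bilinear_compose[OF F(1) bilinear_tensor[OF assms(1,2)]]
          \<beta> B(2) C(2)])
  with F(1) show "\<exists>F. Vector_Spaces.linear tensor_scale r F \<and> (\<forall>v w. F (tensor s t v w) = \<beta> v w)"
    by (intro exI conjI allI)
qed


section \<open>The Drinfeld center of twisted graded vector spaces\<close>

text \<open>The underlying vector space of an object is the whole type \<open>'v\<close> with scalar multiplication
  \<open>scl V\<close>; \<open>hom_comp V x\<close> is its component of degree \<open>x\<close> and \<open>act V p\<close> is the map \<open>p \<triangleright>\<close>.\<close>

record ('g, 'v) graded_rep =
  scl :: "complex \<Rightarrow> 'v \<Rightarrow> 'v"
  hom_comp :: "'g \<Rightarrow> 'v set"
  act :: "'g \<Rightarrow> 'v \<Rightarrow> 'v"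

definition center_object ::
  "('g, 'm) monoid_scheme \<Rightarrow> ('g \<Rightarrow> 'g \<Rightarrow> 'g \<Rightarrow> complex) \<Rightarrow> ('g, 'v::ab_group_add) graded_rep \<Rightarrow> bool"
  where "center_object G \<omega> V \<longleftrightarrow>
    vector_space (scl V) \<and>
    (\<exists>B. finite B \<and> module.span (scl V) B = UNIV) \<and>
    (\<forall>x\<in>carrier G. module.subspace (scl V) (hom_comp V x)) \<and>
    (\<forall>v. \<exists>!f. f \<in> (\<Pi>\<^sub>E x\<in>carrier G. hom_comp V x) \<and> v = (\<Sum>x\<in>carrier G. f x)) \<and>
    (\<forall>p\<in>carrier G. Vector_Spaces.linear (scl V) (scl V) (act V p)) \<and>
    (\<forall>p\<in>carrier G. \<forall>x\<in>carrier G. \<forall>v\<in>hom_comp V x. act V p v \<in> hom_comp V (p \<triangleright>\<^bsub>G\<^esub> x)) \<and>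
    (\<forall>v. act V \<one>\<^bsub>G\<^esub> v = v) \<and>
    (\<forall>p\<in>carrier G. \<forall>q\<in>carrier G. \<forall>x\<in>carrier G. \<forall>v\<in>hom_comp V x.
       act V p (act V q v) = scl V (proj_cocycle G \<omega> x p q) (act V (p \<otimes>\<^bsub>G\<^esub> q) v))"

definition center_subobject ::
  "('g, 'm) monoid_scheme \<Rightarrow> ('g, 'v::ab_group_add) graded_rep \<Rightarrow> 'v set \<Rightarrow> bool"
  where "center_subobject G V U \<longleftrightarrow>
    module.subspace (scl V) U \<and>
    U = module.span (scl V) (\<Union>x\<in>carrier G. U \<inter> hom_comp V x) \<and>
    (\<forall>p\<in>carrier G. act V p ` U \<subseteq> U)"

definition simple_object ::
  "('g, 'm) monoid_scheme \<Rightarrow> ('g \<Rightarrow> 'g \<Rightarrow> 'g \<Rightarrow> complex) \<Rightarrow> ('g, 'v::ab_group_add) graded_rep \<Rightarrow> bool"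
  where "simple_object G \<omega> V \<longleftrightarrow>
    center_object G \<omega> V \<and> (UNIV :: 'v set) \<noteq> {0} \<and>
    (\<forall>U. center_subobject G V U \<longrightarrow> U = {0} \<or> U = UNIV)"

definition support :: "('g, 'm) monoid_scheme \<Rightarrow> ('g, 'v::ab_group_add) graded_rep \<Rightarrow> 'g set"
  where "support G V = {x \<in> carrier G. hom_comp V x \<noteq> {0}}"

text \<open>\<open>comp_char V x\<close> is the projective character of the centralizer of \<open>x\<close> acting on the component
  of degree \<open>x\<close> (only its values on that centralizer are meaningful).  If \<open>V\<close> corresponds to
  \<open>(g, \<chi>)\<close> and \<open>x\<close> is conjugate to \<open>g\<close>, this is the transported character \<open>\<chi>\<^sup>x\<close>.\<close>

definition comp_char :: "('g, 'v::ab_group_add) graded_rep \<Rightarrow> 'g \<Rightarrow> 'g \<Rightarrow> complex"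
  where "comp_char V x c = trace_on (scl V) (hom_comp V x) (act V c)"

definition corresponds_to ::
  "('g, 'm) monoid_scheme \<Rightarrow> ('g, 'v::ab_group_add) graded_rep \<Rightarrow> 'g \<Rightarrow> ('g \<Rightarrow> complex) \<Rightarrow> bool"
  where "corresponds_to G V g \<chi> \<longleftrightarrow>
    g \<in> carrier G \<and> support G V = conj_class G g \<and> (\<forall>c\<in>centralizer G g. \<chi> c = comp_char V g c)"

text \<open>The braiding \<open>V \<otimes> W \<rightarrow> W \<otimes> V\<close>.  The defining property determines it on
  \<open>tensor_space (scl V) (scl W)\<close>; its values outside that subspace are irrelevant.  Existence is
  lemma \<open>braiding\<close> below.\<close>

definition braiding ::
  "('g, 'm) monoid_scheme \<Rightarrow> ('g, 'v::ab_group_add) graded_rep \<Rightarrow> ('g, 'w::ab_group_add) graded_rep \<Rightarrow>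
   ('v, 'w) tensor \<Rightarrow> ('w, 'v) tensor"
  where "braiding G V W = (SOME \<sigma>. Vector_Spaces.linear tensor_scale tensor_scale \<sigma> \<and>
    (\<forall>x\<in>carrier G. \<forall>v\<in>hom_comp V x. \<forall>w.
       \<sigma> (tensor (scl V) (scl W) v w) = tensor (scl W) (scl V) (act W x w) v))"

lemma braiding:
  fixes V :: "('g, 'v::ab_group_add) graded_rep" and W :: "('g, 'w::ab_group_add) graded_rep"
  assumes "finite (carrier G)" "center_object G \<omega> V" "center_object G \<omega> W"
  shows "Vector_Spaces.linear tensor_scale tensor_scale (braiding G V W)"
    and "\<lbrakk>x \<in> carrier G; v \<in> hom_comp V x\<rbrakk> \<Longrightarrow>
      braiding G V W (tensor (scl V) (scl W) v w) = tensor (scl W) (scl V) (act W x w) v"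
proof -
  have vsV: "vector_space (scl V)" and vsW: "vector_space (scl W)"
    using assms(2,3) by (simp_all add: center_object_def)
  define P where "P f v \<longleftrightarrow> f \<in> (\<Pi>\<^sub>E x\<in>carrier G. hom_comp V x) \<and> v = (\<Sum>x\<in>carrier G. f x)"
    for f v
  define pr where "pr v = (THE f. P f v)" for v
  have ex1: "\<exists>!f. P f v" for v
    using assms(2) by (simp add: center_object_def P_def)
  have Ppr: "P (pr v) v" for v
    unfolding pr_def using theI'[OF ex1] .
  have pr_eq: "pr v = f" if "P f v" for v f
    using ex1[of v] Ppr[of v] that by blast
  interpret V: vector_space "scl V" by (rule vsV)
  have sub: "V.subspace (hom_comp V x)" if "x \<in> carrier G" for x
    using assms(2) that by (simp add: center_object_def)
  have mem: "pr v x \<in> hom_comp V x" if "x \<in> carrier G" for v x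
    using Ppr[of v] that by (auto simp: P_def PiE_iff)
  have sum: "(\<Sum>x\<in>carrier G. pr v x) = v" for v
    using Ppr[of v] by (simp add: P_def)
  have pr_add: "pr (v + v') x = pr v x + pr v' x" if "x \<in> carrier G" for v v' x
  proof -
    have "P (restrict (\<lambda>x. pr v x + pr v' x) (carrier G)) (v + v')"
      by (auto simp: P_def sum.distrib sum intro!: V.subspace_add sub mem)
    from pr_eq[OF this] show ?thesis using that by simp
  qed
  have pr_scale: "pr (scl V c v) x = scl V c (pr v x)" if "x \<in> carrier G" for c v x
  proof -
    have "P (restrict (\<lambda>x. scl V c (pr v x)) (carrier G)) (scl V c v)"
      by (auto simp: P_def sum V.scale_sum_right[symmetric] intro!: V.subspace_scale sub mem)
    from pr_eq[OF this] show ?thesis using that by simp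
  qed
  have pr_hom: "pr v y = (if y = x then v else 0)"
    if "x \<in> carrier G" "y \<in> carrier G" "v \<in> hom_comp V x" for v x y
  proof -
    have "P (restrict (\<lambda>y. if y = x then v else 0) (carrier G)) v"
      using that assms(1) by (auto simp: P_def intro!: V.subspace_0 sub)
    from pr_eq[OF this] show ?thesis using that by simp
  qed
  have act: "act W x (w + w') = act W x w + act W x w'"
    "act W x (scl W c w) = scl W c (act W x w)" if "x \<in> carrier G" for x w w' c
    using assms(3) that by (simp_all add: center_object_def Vector_Spaces.linear_iff)
  have bil: "bilinear_map (scl W) (scl V) tensor_scale (tensor (scl W) (scl V))"
    by (rule bilinear_tensor) (rule vsW vsV)+
  have ten: "tensor (scl W) (scl V) (w + w') v = tensor (scl W) (scl V) w v + tensor (scl W) (scl V) w' v"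
    "tensor (scl W) (scl V) w (v + v') = tensor (scl W) (scl V) w v + tensor (scl W) (scl V) w v'"
    "tensor (scl W) (scl V) (scl W c w) v = tensor_scale c (tensor (scl W) (scl V) w v)"
    "tensor (scl W) (scl V) w (scl V c v) = tensor_scale c (tensor (scl W) (scl V) w v)" for v v' w w' c
    using bil by (simp_all add: bilinear_map_def Vector_Spaces.linear_iff)
  interpret X: vector_space "tensor_scale :: complex \<Rightarrow> ('w, 'v) tensor \<Rightarrow> ('w, 'v) tensor"
    by (rule vector_space_tensor_scale)
  define \<beta> where "\<beta> v w = (\<Sum>x\<in>carrier G. tensor (scl W) (scl V) (act W x w) (pr v x))" for v w
  have "bilinear_map (scl V) (scl W) tensor_scale \<beta>"
    unfolding bilinear_map_def \<beta>_def
    by (intro conjI allI linearI vsV vsW vector_space_tensor_scale)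
      (simp_all add: pr_add pr_scale act ten sum.distrib X.scale_sum_right)
  from tensor_universal(1)[OF vsV vsW this] obtain F where
    F: "Vector_Spaces.linear tensor_scale tensor_scale F"
      "\<And>v w. F (tensor (scl V) (scl W) v w) = \<beta> v w" by blast
  have "\<beta> v w = tensor (scl W) (scl V) (act W x w) v"
    if x: "x \<in> carrier G" "v \<in> hom_comp V x" for x v w
  proof -
    have 0: "tensor (scl W) (scl V) w 0 = 0" for w
      using ten(4)[of w 0 0] by simp
    have "\<beta> v w = (\<Sum>y\<in>carrier G. if y = x then tensor (scl W) (scl V) (act W x w) v else 0)"
      unfolding \<beta>_def by (rule sum.cong) (simp_all add: pr_hom[OF x(1) _ x(2)] 0)
    then show ?thesis using assms(1) x by simp
  qed
  with F have "\<exists>\<sigma>. Vector_Spaces.linear tensor_scale tensor_scale \<sigma> \<and>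
    (\<forall>x\<in>carrier G. \<forall>v\<in>hom_comp V x. \<forall>w.
       \<sigma> (tensor (scl V) (scl W) v w) = tensor (scl W) (scl V) (act W x w) v)" by auto
  note * = someI_ex[OF this, folded braiding_def]
  show "Vector_Spaces.linear tensor_scale tensor_scale (braiding G V W)"
    using * by blast
  show "braiding G V W (tensor (scl V) (scl W) v w) = tensor (scl W) (scl V) (act W x w) v"
    if "x \<in> carrier G" "v \<in> hom_comp V x"
    using * that by blast
qed

definition S_matrix ::
  "('g, 'm) monoid_scheme \<Rightarrow> ('g, 'v::ab_group_add) graded_rep \<Rightarrow> ('g, 'w::ab_group_add) graded_rep \<Rightarrow>
   complex"
  where "S_matrix G V W =
    trace_on tensor_scale (tensor_space (scl V) (scl W)) (braiding G W V \<circ> braiding G V W)"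

end

theory Submission
  imports Defs
begin

text \<open>
  Choose bases of \<open>V\<close> and \<open>W\<close> consisting of homogeneous vectors.  For \<open>b\<close> of degree \<open>x\<close> and \<open>c\<close> of
  degree \<open>y\<close> the double braiding sends \<open>b \<otimes> c\<close> to \<open>((x \<triangleright> y) \<triangleright> b) \<otimes> (x \<triangleright> c)\<close>.  The second factor has degree
  \<open>x \<triangleright> y\<close>, so \<open>b \<otimes> c\<close> contributes to the trace only if \<open>x\<close> and \<open>y\<close> commute; in that case the basis
  vectors of \<open>V\<^sub>x \<otimes> W\<^sub>y\<close> together contribute the trace of \<open>y\<close> on \<open>V\<^sub>x\<close> times the trace of \<open>x\<close> on
  \<open>W\<^sub>y\<close>.  Hence \<open>S\<close> is the sum of \<open>\<chi>\<^sub>1\<^sup>x(y) \<chi>\<^sub>2\<^sup>y(x)\<close> over all commuting pairs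
  (\<open>S_matrix_eq_sum_commuting\<close>).

  The operator \<open>p \<triangleright>\<close> maps \<open>V\<^sub>x\<close> isomorphically onto the component of degree \<open>p \<triangleright> x\<close> and intertwines the
  actions of \<open>y\<close> and \<open>p \<triangleright> y\<close> up to the scalar \<open>\<alpha>\<^sub>x(p \<triangleright> y, p) / \<alpha>\<^sub>x(p, y)\<close>
  (\<open>comp_char_conjugate\<close>).  A single character value is therefore conjugation invariant only up to this
  scalar, but in the product \<open>\<chi>\<^sub>1\<^sup>x(y) \<chi>\<^sub>2\<^sup>y(x)\<close> the two scalars are inverse to each other
  (\<open>comp_char_mult_conjugate\<close>).  So each \<open>y\<close> in the class of \<open>h\<close> contributes as much as \<open>h\<close> itself,
  which gives the first formula.  The second one replaces the sum over the class of \<open>g\<close> by a sum over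
  \<open>G\<close> along \<open>p \<mapsto> p \<triangleright> g\<close>, whose fibres are cosets of the centralizer of \<open>g\<close>, and expresses
  the transported character of \<open>p \<triangleright> g\<close> through \<open>\<chi>\<^sub>1\<close> by the same intertwining scalar.
\<close>

section \<open>Bases and traces\<close>

lemma finite_basis_of_subspace:
  assumes "vector_space s" "finite A" "module.span s A = UNIV" "module.subspace s S"
  obtains B where "finite B" "\<not> module.dependent s B" "module.span s B = S"
proof -
  interpret vector_space s by fact
  obtain B where B: "B \<subseteq> S" "independent B" "S \<subseteq> span B"
    by (rule maximal_independent_subset)
  have "finite B"
    using independent_span_bound[OF assms(2) B(2)] assms(3) by auto
  moreover have "span B = S"
    using span_minimal[OF B(1) assms(4)] B(3) by blast
  ultimately show ?thesis
    using that B(2) by blast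
qed

text \<open>The directness of the sum of the \<open>H i\<close> enters as the uniqueness of the decomposition of \<open>0\<close>: a linear
  relation on the union, sorted by summands, is such a decomposition.\<close>

lemma independent_Union_direct_sum:
  fixes s :: "complex \<Rightarrow> 'v::ab_group_add \<Rightarrow> 'v"
  assumes s: "vector_space s" and I: "finite I"
    and uniq: "\<And>f. f \<in> (\<Pi>\<^sub>E i\<in>I. H i) \<Longrightarrow> (\<Sum>i\<in>I. f i) = 0 \<Longrightarrow> \<forall>i\<in>I. f i = 0"
    and B: "\<And>i. i \<in> I \<Longrightarrow> finite (B i)" "\<And>i. i \<in> I \<Longrightarrow> \<not> module.dependent s (B i)"
      "\<And>i. i \<in> I \<Longrightarrow> module.span s (B i) = H i"
  shows "\<And>i j. i \<in> I \<Longrightarrow> j \<in> I \<Longrightarrow> i \<noteq> j \<Longrightarrow> B i \<inter> B j = {}"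
    and "\<not> module.dependent s (\<Union>i\<in>I. B i)"
proof -
  interpret vector_space s by fact
  show disj: "B i \<inter> B j = {}" if ij: "i \<in> I" "j \<in> I" "i \<noteq> j" for i j
  proof (rule equals0I)
    fix b assume b: "b \<in> B i \<inter> B j"
    \<comment> \<open>A common element \<open>b\<close> would give the decomposition \<open>0 = b + (- b)\<close> in \<open>H i + H j\<close>.\<close>
    define f where "f = (\<lambda>k\<in>I. if k = i then b else if k = j then - b else 0)"
    have "b \<in> H i" "- b \<in> H j"
      using b B(3)[OF ij(1)] B(3)[OF ij(2)] by (auto intro: span_base span_neg)
    moreover have "0 \<in> H k" if "k \<in> I" for k
      using B(3)[OF that] span_zero by auto
    ultimately have "f \<in> (\<Pi>\<^sub>E i\<in>I. H i)"
      by (auto simp: f_def)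
    moreover have "(\<Sum>k\<in>I. f k) = (\<Sum>k\<in>I. (if k = i then b else 0) + (if k = j then - b else 0))"
      using ij(3) by (intro sum.cong) (auto simp: f_def)
    then have "(\<Sum>k\<in>I. f k) = 0"
      using ij I by (simp add: sum.distrib)
    ultimately have "f i = 0"
      using uniq ij(1) by blast
    then have "b = 0"
      using ij(1) by (simp add: f_def)
    then show False
      using b B(2)[OF ij(1)] dependent_zero by blast
  qed
  show "independent (\<Union>i\<in>I. B i)"
  proof (rule independent_if_scalars_zero)
    show "finite (\<Union>i\<in>I. B i)"
      using I B(1) by blast
    fix u b assume u: "(\<Sum>b\<in>(\<Union>i\<in>I. B i). s (u b) b) = 0" and b: "b \<in> (\<Union>i\<in>I. B i)"
    define f where "f = (\<lambda>i\<in>I. \<Sum>b\<in>B i. s (u b) b)"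
    have "f \<in> (\<Pi>\<^sub>E i\<in>I. H i)"
    proof (rule PiE_I)
      fix i assume i: "i \<in> I"
      have "(\<Sum>b\<in>B i. s (u b) b) \<in> span (B i)"
        by (intro span_sum span_scale span_base)
      then show "f i \<in> H i"
        using i B(3) by (simp add: f_def)
    qed (simp add: f_def)
    moreover have "(\<Sum>i\<in>I. f i) = 0"
      using u I B(1) disj by (simp add: f_def sum.UNION_disjoint)
    ultimately have "\<forall>i\<in>I. f i = 0"
      by (rule uniq)
    moreover obtain i where i: "i \<in> I" "b \<in> B i"
      using b by blast
    ultimately have "(\<Sum>b\<in>B i. s (u b) b) = 0"
      by (auto simp: f_def)
    then show "u b = 0"
      using independentD[OF B(2)[OF i(1)] B(1)[OF i(1)] order_refl] i(2) by blast
  qed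
qed

lemma trace_on_zero:
  assumes "Vector_Spaces.linear s s f"
  shows "trace_on s {0} f = 0"
proof -
  interpret f: Vector_Spaces.linear s s f by fact
  have "trace_on s {0} f = (\<Sum>b\<in>{}. f.vs1.representation {} (f b) b)"
    by (rule trace_on_eq[OF assms]) (simp_all add: f.vs1.independent_empty f.zero)
  then show ?thesis by simp
qed

text \<open>The matrix of \<open>f'\<close> in the basis \<open>P ` B\<close> is \<open>k\<close> times the matrix of \<open>f\<close> in the basis \<open>B\<close>.
  The scalar is what a projective action needs beyond ordinary invariance of the trace.\<close>

lemma trace_on_twisted_conjugate:
  fixes s :: "complex \<Rightarrow> 'v::ab_group_add \<Rightarrow> 'v"
  assumes f: "Vector_Spaces.linear s s f" and f': "Vector_Spaces.linear s s f'"
    and P: "Vector_Spaces.linear s s P" and inj: "inj_on P S"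
    and B: "finite B" "\<not> module.dependent s B" "module.span s B = S"
    and inv: "f ` S \<subseteq> S"
    and tw: "\<And>v. v \<in> S \<Longrightarrow> f' (P v) = s k (P (f v))"
  shows "trace_on s (P ` S) f' = k * trace_on s S f"
proof -
  interpret f: Vector_Spaces.linear s s f by fact
  interpret P: Vector_Spaces.linear s s P by fact
  have BS: "B \<subseteq> S"
    using f.vs1.span_superset[of B] B(3) by simp
  have indep: "\<not> f.vs1.dependent (P ` B)"
    using P.independent_inj_on_image[OF B(2)] inj B(3) by simp
  have span: "f.vs1.span (P ` B) = P ` S"
    using P.span_image[of B] B(3) by simp
  have inv': "f' ` P ` S \<subseteq> P ` S"
  proof clarify
    fix v assume v: "v \<in> S"
    have "f.vs1.span (P ` B) = P ` S" by (rule span)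
    moreover have "P (f v) \<in> P ` S" using inv v by blast
    ultimately show "f' (P v) \<in> P ` S"
      using f.vs1.span_scale[of "P (f v)" "P ` B" k] tw[OF v] by simp
  qed
  have coord: "f.vs1.representation (P ` B) (P v) (P b) = f.vs1.representation B v b"
    if "v \<in> S" "b \<in> B" for v b
  proof -
    have "v = (\<Sum>c\<in>B. s (f.vs1.representation B v c) c)"
      using f.vs1.sum_representation_eq[OF B(2) _ B(1) order_refl, of v] that B(3) by simp
    then have "P v = (\<Sum>c\<in>B. s (f.vs1.representation B v c) (P c))"
      by (metis (no_types, lifting) P.sum P.scale sum.cong)
    then have "f.vs1.representation (P ` B) (P v) (P b)
        = (\<Sum>c\<in>B. f.vs1.representation B v c * f.vs1.representation (P ` B) (P c) (P b))"
      by (simp add: f.vs1.representation_sum[OF indep] f.vs1.representation_scale[OF indep]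
          f.vs1.span_scale f.vs1.span_base)
    also have "\<dots> = (\<Sum>c\<in>B. if c = b then f.vs1.representation B v c else 0)"
      using inj BS that(2)
      by (intro sum.cong refl) (auto simp: f.vs1.representation_basis[OF indep] inj_on_def subset_iff)
    finally show ?thesis
      using that(2) B(1) by simp
  qed
  have "trace_on s (P ` S) f' = (\<Sum>b\<in>P ` B. f.vs1.representation (P ` B) (f' b) b)"
    by (rule trace_on_eq[OF f' _ indep span inv']) (simp add: B(1))
  also have "\<dots> = (\<Sum>b\<in>B. f.vs1.representation (P ` B) (f' (P b)) (P b))"
    using inj_on_subset[OF inj BS] by (simp add: sum.reindex)
  also have "\<dots> = (\<Sum>b\<in>B. k * f.vs1.representation B (f b) b)"
  proof (rule sum.cong[OF refl])
    fix b assume b: "b \<in> B"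
    then have fb: "f b \<in> S" "b \<in> S" using BS inv by auto
    then show "f.vs1.representation (P ` B) (f' (P b)) (P b) = k * f.vs1.representation B (f b) b"
      using coord[OF fb(1) b] tw[OF fb(2)] span
      by (simp add: f.vs1.representation_scale[OF indep])
  qed
  also have "\<dots> = k * trace_on s S f"
    by (simp add: trace_on_eq[OF f B inv] sum_distrib_left)
  finally show ?thesis .
qed

text \<open>The functions \<open>f\<close> and \<open>k\<close> may depend on both basis vectors, because the double braiding is not a
  tensor product of two maps: it becomes one only after fixing the degrees of its arguments.\<close>

lemma trace_on_tensor_space:
  fixes s :: "complex \<Rightarrow> 'v::ab_group_add \<Rightarrow> 'v" and t :: "complex \<Rightarrow> 'w::ab_group_add \<Rightarrow> 'w"
  assumes s: "vector_space s" and t: "vector_space t"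
    and B: "finite B" "\<not> module.dependent s B" "module.span s B = UNIV"
    and C: "finite C" "\<not> module.dependent t C" "module.span t C = UNIV"
    and F: "Vector_Spaces.linear tensor_scale tensor_scale F"
    and Fbc: "\<And>b c. b \<in> B \<Longrightarrow> c \<in> C \<Longrightarrow> F (tensor s t b c) = tensor s t (f b c) (k b c)"
  shows "trace_on tensor_scale (tensor_space s t) F =
    (\<Sum>b\<in>B. \<Sum>c\<in>C. module.representation s B (f b c) b * module.representation t C (k b c) c)"
proof -
  interpret S: vector_space s by fact
  interpret T: vector_space t by fact
  interpret F: Vector_Spaces.linear "tensor_scale :: complex \<Rightarrow> ('v, 'w) tensor \<Rightarrow> ('v, 'w) tensor"
    "tensor_scale :: complex \<Rightarrow> ('v, 'w) tensor \<Rightarrow> ('v, 'w) tensor" F by fact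
  let ?t = "\<lambda>(b, c). tensor s t b c"
  let ?X = "?t ` (B \<times> C)"
  note basis = tensor_basis[OF s t B(2,3) C(2,3)]
  have bil: "bilinear_map s t tensor_scale (tensor s t)"
    by (rule bilinear_tensor[OF s t])
  have expand: "tensor s t v w = (\<Sum>z\<in>B \<times> C. tensor_scale
      (S.representation B v (fst z) * T.representation C w (snd z)) (?t z))" for v w
  proof -
    interpret L: Vector_Spaces.linear s tensor_scale "\<lambda>v. tensor s t v w'" for w'
      using bil by (simp add: bilinear_map_def)
    interpret R: Vector_Spaces.linear t tensor_scale "tensor s t v'" for v'
      using bil by (simp add: bilinear_map_def)
    have v: "v = (\<Sum>b\<in>B. s (S.representation B v b) b)"
      using S.sum_representation_eq[OF B(2) _ B(1) order_refl, of v] B(3) by simp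
    have w: "w = (\<Sum>c\<in>C. t (T.representation C w c) c)"
      using T.sum_representation_eq[OF C(2) _ C(1) order_refl, of w] C(3) by simp
    have "tensor s t v w = (\<Sum>b\<in>B. tensor_scale (S.representation B v b) (tensor s t b w))"
      by (subst v) (simp only: L.sum L.scale)
    also have "\<dots> = (\<Sum>b\<in>B. \<Sum>c\<in>C. tensor_scale
        (S.representation B v b * T.representation C w c) (tensor s t b c))"
      by (subst w) (simp only: R.sum R.scale F.vs1.scale_sum_right F.vs1.scale_scale)
    finally show ?thesis
      by (simp only: sum.cartesian_product split_def fst_conv snd_conv)
  qed
  have span_t: "tensor s t v w \<in> F.vs1.span ?X" for v w
    by (subst expand) (intro F.vs1.span_sum F.vs1.span_scale F.vs1.span_base imageI)
  have span: "F.vs1.span ?X = tensor_space s t"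
    unfolding tensor_space_def
  proof (rule antisym)
    show "F.vs1.span ?X \<subseteq> F.vs1.span {tensor s t v w |v w. True}"
      by (rule F.vs1.span_mono) auto
    show "F.vs1.span {tensor s t v w |v w. True} \<subseteq> F.vs1.span ?X"
      by (rule F.vs1.span_minimal[OF _ F.vs1.subspace_span]) (use span_t in blast)
  qed
  have inv: "F ` tensor_space s t \<subseteq> tensor_space s t"
    unfolding span[symmetric] F.span_image[symmetric]
  proof (rule F.vs1.span_minimal[OF _ F.vs1.subspace_span], safe)
    fix b c assume "b \<in> B" "c \<in> C"
    then show "F (tensor s t b c) \<in> F.vs1.span ?X"
      by (simp only: Fbc span_t)
  qed
  have coord: "F.vs1.representation ?X (tensor s t v w) (?t z)
      = S.representation B v (fst z) * T.representation C w (snd z)" if z: "z \<in> B \<times> C" for v w z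
  proof -
    let ?r = "\<lambda>z. S.representation B v (fst z) * T.representation C w (snd z)"
    have "F.vs1.representation ?X (tensor s t v w) (?t z)
        = (\<Sum>y\<in>B \<times> C. F.vs1.representation ?X (tensor_scale (?r y) (?t y)) (?t z))"
      by (subst expand, subst F.vs1.representation_sum[OF basis(2)])
        (rule F.vs1.span_scale[OF F.vs1.span_base[OF imageI]], assumption, rule refl)
    also have "\<dots> = (\<Sum>y\<in>B \<times> C. ?r y * (if ?t z = ?t y then 1 else 0))"
    proof (rule sum.cong[OF refl])
      fix y assume y: "y \<in> B \<times> C"
      show "F.vs1.representation ?X (tensor_scale (?r y) (?t y)) (?t z)
          = ?r y * (if ?t z = ?t y then 1 else 0)"
        by (simp only: F.vs1.representation_scale[OF basis(2) F.vs1.span_base[OF imageI[OF y]]]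
            F.vs1.representation_basis[OF basis(2) imageI[OF y]])
    qed
    also have "\<dots> = (\<Sum>y\<in>B \<times> C. if z = y then ?r y else 0)"
    proof (rule sum.cong[OF refl])
      fix y assume y: "y \<in> B \<times> C"
      show "?r y * (if ?t z = ?t y then 1 else 0) = (if z = y then ?r y else 0)"
        using inj_on_eq_iff[OF basis(1) z y] by (simp only: mult_1_right mult_zero_right split: if_split) simp
    qed
    finally show ?thesis
      using z B(1) C(1) by (simp only: sum.delta' finite_cartesian_product if_True)
  qed
  have "trace_on tensor_scale (tensor_space s t) F = (\<Sum>x\<in>?X. F.vs1.representation ?X (F x) x)"
    by (rule trace_on_eq[OF F _ basis(2) span inv]) (simp add: B(1) C(1))
  also have "\<dots> = (\<Sum>z\<in>B \<times> C. F.vs1.representation ?X (F (?t z)) (?t z))"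
    by (simp only: sum.reindex[OF basis(1)] o_def)
  also have "\<dots> = (\<Sum>(b, c)\<in>B \<times> C. S.representation B (f b c) b * T.representation C (k b c) c)"
  proof (rule sum.cong[OF refl], clarify)
    fix b c assume bc: "b \<in> B" "c \<in> C"
    then have z: "(b, c) \<in> B \<times> C" by simp
    show "F.vs1.representation ?X (F (tensor s t b c)) (tensor s t b c)
        = S.representation B (f b c) b * T.representation C (k b c) c"
      using coord[OF z] by (simp only: Fbc[OF bc] prod.case fst_conv snd_conv)
  qed
  finally show ?thesis
    by (simp only: sum.cartesian_product)
qed

section \<open>Conjugation\<close>

context group
begin

lemma conjugate_closed [simp]:
  "\<lbrakk>p \<in> carrier G; x \<in> carrier G\<rbrakk> \<Longrightarrow> p \<triangleright> x \<in> carrier G"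
  by (simp add: conjugate_def)

lemma conjugate_mult:
  "\<lbrakk>p \<in> carrier G; q \<in> carrier G; x \<in> carrier G\<rbrakk> \<Longrightarrow> (p \<otimes> q) \<triangleright> x = p \<triangleright> (q \<triangleright> x)"
  by (simp add: conjugate_def m_assoc inv_mult_group)

lemma conjugate_one: "x \<in> carrier G \<Longrightarrow> \<one> \<triangleright> x = x"
  by (simp add: conjugate_def)

lemma conjugate_inv_conjugate [simp]:
  assumes "p \<in> carrier G" "x \<in> carrier G"
  shows "inv p \<triangleright> (p \<triangleright> x) = x" "p \<triangleright> (inv p \<triangleright> x) = x"
  using assms by (simp_all add: conjugate_mult[symmetric] conjugate_one)

lemma conjugate_mult_right:
  "\<lbrakk>p \<in> carrier G; x \<in> carrier G\<rbrakk> \<Longrightarrow> (p \<triangleright> x) \<otimes> p = p \<otimes> x"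
  by (simp add: conjugate_def m_assoc)

lemma conjugate_eq_iff_mult:
  assumes "p \<in> carrier G" "x \<in> carrier G" "y \<in> carrier G"
  shows "p \<triangleright> x = y \<longleftrightarrow> p \<otimes> x = y \<otimes> p"
  using assms by (metis conjugate_closed conjugate_mult_right right_cancel)

lemma conjugate_commute_iff:
  assumes "p \<in> carrier G" "x \<in> carrier G" "y \<in> carrier G"
  shows "(p \<triangleright> x) \<otimes> (p \<triangleright> y) = (p \<triangleright> y) \<otimes> (p \<triangleright> x) \<longleftrightarrow> x \<otimes> y = y \<otimes> x"
proof -
  have "(p \<triangleright> a) \<otimes> (p \<triangleright> b) = p \<triangleright> (a \<otimes> b)" if "a \<in> carrier G" "b \<in> carrier G" for a b
  proof -
    have "inv p \<otimes> (p \<otimes> c) = c" if "c \<in> carrier G" for c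
      using that assms(1) by (simp add: m_assoc[symmetric])
    then show ?thesis
      using that assms(1) by (simp add: conjugate_def m_assoc)
  qed
  then show ?thesis
    using assms by (metis conjugate_inv_conjugate(1) m_closed)
qed

lemma commutator_eq_one_iff:
  assumes "x \<in> carrier G" "y \<in> carrier G"
  shows "commutator G x y = \<one> \<longleftrightarrow> x \<otimes> y = y \<otimes> x"
proof -
  have "commutator G x y = (x \<otimes> y) \<otimes> inv (y \<otimes> x)"
    using assms by (simp add: commutator_def m_assoc inv_mult_group)
  then show ?thesis
    using assms by (metis inv_closed inv_equality inv_inv m_closed r_inv)
qed

lemma conj_class_closed: "g \<in> carrier G \<Longrightarrow> conj_class G g \<subseteq> carrier G"
  by (auto simp: conj_class_def)

lemma conjugate_in_conj_class_iff:
  assumes "p \<in> carrier G" "x \<in> carrier G" "g \<in> carrier G"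
  shows "p \<triangleright> x \<in> conj_class G g \<longleftrightarrow> x \<in> conj_class G g"
proof
  show "p \<triangleright> x \<in> conj_class G g" if "x \<in> conj_class G g"
    using that assms by (auto simp: conj_class_def conjugate_mult[symmetric])
  show "x \<in> conj_class G g" if px: "p \<triangleright> x \<in> conj_class G g"
  proof -
    obtain q where "q \<in> carrier G" "p \<triangleright> x = q \<triangleright> g"
      using px by (auto simp: conj_class_def)
    then have "x = (inv p \<otimes> q) \<triangleright> g" "inv p \<otimes> q \<in> carrier G"
      using assms by (simp_all add: conjugate_mult) (metis conjugate_inv_conjugate(1))
    then show ?thesis
      by (auto simp: conj_class_def)
  qed
qed

text \<open>The fibre is a left coset of the centralizer.\<close>

lemma card_conjugate_fibre:
  assumes g: "g \<in> carrier G" and x: "x \<in> conj_class G g"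
  shows "card {p \<in> carrier G. p \<triangleright> g = x} = card (centralizer G g)"
proof -
  obtain q where q: "q \<in> carrier G" "x = q \<triangleright> g"
    using x by (auto simp: conj_class_def)
  have "bij_betw (\<lambda>c. q \<otimes> c) (centralizer G g) {p \<in> carrier G. p \<triangleright> g = x}"
  proof (rule bij_betw_byWitness[where f' = "\<lambda>p. inv q \<otimes> p"])
    show "\<forall>c\<in>centralizer G g. inv q \<otimes> (q \<otimes> c) = c"
      using q(1) by (auto simp: centralizer_def m_assoc[symmetric])
    show "\<forall>p\<in>{p \<in> carrier G. p \<triangleright> g = x}. q \<otimes> (inv q \<otimes> p) = p"
      using q(1) by (auto simp: m_assoc[symmetric])
    show "(\<lambda>c. q \<otimes> c) ` centralizer G g \<subseteq> {p \<in> carrier G. p \<triangleright> g = x}"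
    proof clarify
      fix c assume c: "c \<in> centralizer G g"
      then have "c \<in> carrier G" "c \<triangleright> g = g"
        using g by (auto simp: centralizer_def conjugate_eq_iff_mult)
      then show "q \<otimes> c \<in> carrier G \<and> (q \<otimes> c) \<triangleright> g = x"
        using q g by (simp add: conjugate_mult)
    qed
    show "(\<lambda>p. inv q \<otimes> p) ` {p \<in> carrier G. p \<triangleright> g = x} \<subseteq> centralizer G g"
    proof clarify
      fix p assume p: "p \<in> carrier G" "x = p \<triangleright> g"
      then have "(inv q \<otimes> p) \<triangleright> g = g"
        using q g by (metis conjugate_inv_conjugate(1) conjugate_mult inv_closed)
      then show "inv q \<otimes> p \<in> centralizer G g"
        using p q g by (simp add: centralizer_def conjugate_eq_iff_mult)
    qed
  qed
  then show ?thesis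
    by (rule bij_betw_same_card[symmetric])
qed

end


section \<open>Characters of objects of the center\<close>

lemma proj_cocycle_nonzero:
  fixes G (structure)
  assumes "group G" "normalized_3_cocycle G \<omega>" "x \<in> carrier G" "p \<in> carrier G" "q \<in> carrier G"
  shows "proj_cocycle G \<omega> x p q \<noteq> 0"
proof -
  interpret group G by fact
  show ?thesis
    using assms(2-5) by (simp add: normalized_3_cocycle_def proj_cocycle_def)
qed

lemma act_in_hom_comp:
  fixes G (structure)
  assumes "center_object G \<omega> V" "p \<in> carrier G" "x \<in> carrier G" "v \<in> hom_comp V x"
  shows "act V p v \<in> hom_comp V (p \<triangleright> x)"
  using assms by (simp add: center_object_def)

text \<open>On each component \<open>p \<triangleright>\<close> composed with \<open>p\<inverse> \<triangleright>\<close> is multiplication by a value of \<open>\<alpha>\<close>, not the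
  identity; invertibility comes from that value being nonzero.\<close>

lemma act_bijective:
  fixes G (structure)
  assumes G: "group G" and \<omega>: "normalized_3_cocycle G \<omega>" and V: "center_object G \<omega> V"
    and p: "p \<in> carrier G" and x: "x \<in> carrier G"
  shows "inj_on (act V p) (hom_comp V x)"
    and "act V p ` hom_comp V x = hom_comp V (p \<triangleright> x)"
proof -
  interpret group G by fact
  interpret vector_space "scl V"
    using V by (simp add: center_object_def)
  let ?\<alpha> = "proj_cocycle G \<omega>"
  note act = act_in_hom_comp[OF V]
  have act_inv: "act V q (act V (inv q) v) = scl V (?\<alpha> y q (inv q)) v"
    and inv_act: "act V (inv q) (act V q v) = scl V (?\<alpha> y (inv q) q) v"
    if "q \<in> carrier G" "y \<in> carrier G" "v \<in> hom_comp V y" for q y v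
    using V that by (simp_all add: center_object_def)
  show "inj_on (act V p) (hom_comp V x)"
  proof (rule inj_onI)
    fix v w assume vw: "v \<in> hom_comp V x" "w \<in> hom_comp V x" "act V p v = act V p w"
    then have "scl V (?\<alpha> x (inv p) p) v = scl V (?\<alpha> x (inv p) p) w"
      using inv_act[OF p x vw(1)] inv_act[OF p x vw(2)] by metis
    then show "v = w"
      using proj_cocycle_nonzero[OF G \<omega> x inv_closed[OF p] p] by (simp only: scale_cancel_left) simp
  qed
  have "v \<in> act V p ` hom_comp V x" if v: "v \<in> hom_comp V (p \<triangleright> x)" for v
  proof -
    let ?k = "?\<alpha> (p \<triangleright> x) p (inv p)"
    have px: "p \<triangleright> x \<in> carrier G" using p x by simp
    have "?k \<noteq> 0" by (rule proj_cocycle_nonzero[OF G \<omega> px p inv_closed[OF p]])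
    moreover have "act V p (scl V (inverse ?k) (act V (inv p) v))
        = scl V (inverse ?k) (act V p (act V (inv p) v))"
      using V p by (simp add: center_object_def Vector_Spaces.linear_iff)
    ultimately have "act V p (scl V (inverse ?k) (act V (inv p) v)) = v"
      using act_inv[OF p px v] by simp
    moreover have "act V (inv p) v \<in> hom_comp V x"
      using act[OF inv_closed[OF p] px v] p x by simp
    then have "scl V (inverse ?k) (act V (inv p) v) \<in> hom_comp V x"
      using V x by (auto simp: center_object_def intro: subspace_scale)
    ultimately show ?thesis
      by (metis imageI)
  qed
  then show "act V p ` hom_comp V x = hom_comp V (p \<triangleright> x)"
    using act[OF p x] by blast
qed

lemma homogeneous_component_basis:
  fixes G (structure)
  assumes V: "center_object G \<omega> V" and x: "x \<in> carrier G"
  obtains B where "finite B" "\<not> module.dependent (scl V) B" "module.span (scl V) B = hom_comp V x"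
proof -
  obtain A where "finite A" "module.span (scl V) A = UNIV"
    using V by (auto simp: center_object_def)
  then show ?thesis
    using V x that by (auto simp: center_object_def intro: finite_basis_of_subspace[of "scl V" A])
qed

text \<open>Since \<open>(p \<triangleright> y) p = p y\<close>, both \<open>(p \<triangleright> y) \<triangleright> (p \<triangleright> v)\<close> and \<open>p \<triangleright> (y \<triangleright> v)\<close> are multiples of
  \<open>(p y) \<triangleright> v\<close>; the quotient of the two factors is the scalar below.\<close>

lemma comp_char_conjugate:
  fixes G (structure)
  assumes G: "group G" and \<omega>: "normalized_3_cocycle G \<omega>" and V: "center_object G \<omega> V"
    and pxy: "p \<in> carrier G" "x \<in> carrier G" "y \<in> carrier G"
    and comm: "x \<otimes> y = y \<otimes> x"
  shows "comp_char V (p \<triangleright> x) (p \<triangleright> y) =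
    proj_cocycle G \<omega> x (p \<triangleright> y) p * inverse (proj_cocycle G \<omega> x p y) * comp_char V x y"
proof -
  interpret group G by fact
  interpret vector_space "scl V"
    using V by (simp add: center_object_def)
  let ?\<alpha> = "proj_cocycle G \<omega> x"
  have lin: "Vector_Spaces.linear (scl V) (scl V) (act V q)" if "q \<in> carrier G" for q
    using V that by (simp add: center_object_def)
  have act2: "act V q (act V r v) = scl V (?\<alpha> q r) (act V (q \<otimes> r) v)"
    if "q \<in> carrier G" "r \<in> carrier G" "v \<in> hom_comp V x" for q r v
    using V that pxy(2) by (simp add: center_object_def)
  obtain B where B: "finite B" "independent B" "span B = hom_comp V x"
    by (rule homogeneous_component_basis[OF V pxy(2)])
  have yx: "y \<triangleright> x = x"
    using pxy comm by (simp add: conjugate_eq_iff_mult)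
  have "comp_char V (p \<triangleright> x) (p \<triangleright> y)
      = trace_on (scl V) (act V p ` hom_comp V x) (act V (p \<triangleright> y))"
    by (simp add: comp_char_def act_bijective(2)[OF G \<omega> V pxy(1,2)])
  also have "\<dots> = (?\<alpha> (p \<triangleright> y) p * inverse (?\<alpha> p y)) * trace_on (scl V) (hom_comp V x) (act V y)"
  proof (rule trace_on_twisted_conjugate[OF lin lin lin act_bijective(1)[OF G \<omega> V pxy(1,2)] B])
    show "act V y ` hom_comp V x \<subseteq> hom_comp V x"
      using act_in_hom_comp[OF V pxy(3,2)] yx by auto
    fix v assume v: "v \<in> hom_comp V x"
    have "?\<alpha> p y \<noteq> 0"
      using proj_cocycle_nonzero[OF G \<omega>] pxy by simp
    then show "act V (p \<triangleright> y) (act V p v)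
        = scl V (?\<alpha> (p \<triangleright> y) p * inverse (?\<alpha> p y)) (act V p (act V y v))"
      using pxy v by (simp add: act2 conjugate_mult_right)
  qed (use pxy in simp_all)
  finally show ?thesis
    by (simp add: comp_char_def)
qed

text \<open>Write \<open>x' = p \<triangleright> x\<close> and \<open>y' = p \<triangleright> y\<close>.  As \<open>x\<close> and \<open>y\<close> commute, the scalar for \<open>V\<close> is
  the quotient of \<open>\<omega>(y',p,x) \<omega>(x',y',p) \<omega>(y',x',p)\<inverse>\<close> by
  \<open>\<omega>(p,y,x) \<omega>(x',p,y) \<omega>(p,x,y)\<inverse>\<close>, and the scalar for \<open>W\<close> is
  obtained by exchanging \<open>x\<close> and \<open>y\<close>.  That exchange inverts the quotient, so the product of the two
  scalars is \<open>1\<close>.\<close>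

lemma comp_char_mult_conjugate:
  fixes G (structure)
  assumes G: "group G" and \<omega>: "normalized_3_cocycle G \<omega>"
    and V: "center_object G \<omega> V" and W: "center_object G \<omega> W"
    and pxy: "p \<in> carrier G" "x \<in> carrier G" "y \<in> carrier G"
    and comm: "x \<otimes> y = y \<otimes> x"
  shows "comp_char V (p \<triangleright> x) (p \<triangleright> y) * comp_char W (p \<triangleright> y) (p \<triangleright> x) =
    comp_char V x y * comp_char W y x"
proof -
  interpret group G by fact
  let ?x = "p \<triangleright> x" and ?y = "p \<triangleright> y"
  have nz: "\<omega> a b c \<noteq> 0" if "a \<in> carrier G" "b \<in> carrier G" "c \<in> carrier G" for a b c
    using \<omega> that by (simp add: normalized_3_cocycle_def)
  have fix_conj: "x \<triangleright> y = y" "y \<triangleright> x = x"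
    using pxy comm by (simp_all add: conjugate_eq_iff_mult)
  have conj: "(?y \<otimes> p) \<triangleright> x = ?x" "(?x \<otimes> p) \<triangleright> y = ?y" "(p \<otimes> y) \<triangleright> x = ?x" "(p \<otimes> x) \<triangleright> y = ?y"
    using pxy fix_conj by (simp_all add: conjugate_mult_right conjugate_mult)
  let ?k = "proj_cocycle G \<omega> x ?y p * inverse (proj_cocycle G \<omega> x p y)"
    and ?l = "proj_cocycle G \<omega> y ?x p * inverse (proj_cocycle G \<omega> y p x)"
  have "comp_char V ?x ?y * comp_char W ?y ?x = (?k * ?l) * (comp_char V x y * comp_char W y x)"
    unfolding comp_char_conjugate[OF G \<omega> V pxy comm]
      comp_char_conjugate[OF G \<omega> W pxy(1,3,2) comm[symmetric]]
    by (simp only: mult_ac)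
  moreover have "?k * ?l = 1"
    using pxy by (simp add: proj_cocycle_def conj fix_conj nz field_simps)
  ultimately show ?thesis
    by simp
qed

lemma homogeneous_basis:
  fixes G (structure) and V :: "('g, 'v::ab_group_add) graded_rep"
  assumes fin: "finite (carrier G)" and V: "center_object G \<omega> V"
  obtains B where
    "\<And>x. x \<in> carrier G \<Longrightarrow> finite (B x)"
    "\<And>x. x \<in> carrier G \<Longrightarrow> module.span (scl V) (B x) = hom_comp V x"
    "\<And>x. x \<in> carrier G \<Longrightarrow> \<not> module.dependent (scl V) (B x)"
    "\<And>x y. x \<in> carrier G \<Longrightarrow> y \<in> carrier G \<Longrightarrow> x \<noteq> y \<Longrightarrow> B x \<inter> B y = {}"
    "\<not> module.dependent (scl V) (\<Union>x\<in>carrier G. B x)"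
    "module.span (scl V) (\<Union>x\<in>carrier G. B x) = UNIV"
proof -
  interpret vector_space "scl V"
    using V by (simp add: center_object_def)
  have dec: "\<exists>!f. f \<in> (\<Pi>\<^sub>E x\<in>carrier G. hom_comp V x) \<and> v = (\<Sum>x\<in>carrier G. f x)" for v
    using V by (simp add: center_object_def)
  have sub: "subspace (hom_comp V x)" if "x \<in> carrier G" for x
    using V that by (simp add: center_object_def)
  have "\<exists>B. finite B \<and> independent B \<and> span B = hom_comp V x" if "x \<in> carrier G" for x
    using homogeneous_component_basis[OF V that] by metis
  then obtain B where B: "\<And>x. x \<in> carrier G \<Longrightarrow> finite (B x)"
    "\<And>x. x \<in> carrier G \<Longrightarrow> independent (B x)"
    "\<And>x. x \<in> carrier G \<Longrightarrow> span (B x) = hom_comp V x"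
    by metis
  have uniq: "\<forall>x\<in>carrier G. f x = 0"
    if f: "f \<in> (\<Pi>\<^sub>E x\<in>carrier G. hom_comp V x)" "(\<Sum>x\<in>carrier G. f x) = 0" for f
  proof -
    let ?z = "\<lambda>x\<in>carrier G. 0"
    have "?z \<in> (\<Pi>\<^sub>E x\<in>carrier G. hom_comp V x)" "0 = (\<Sum>x\<in>carrier G. ?z x)"
      using subspace_0[OF sub] by auto
    moreover obtain e where
      "\<And>f'. f' \<in> (\<Pi>\<^sub>E x\<in>carrier G. hom_comp V x) \<Longrightarrow> 0 = (\<Sum>x\<in>carrier G. f' x) \<Longrightarrow> f' = e"
      using dec[of 0] by (elim ex1E) blast
    ultimately have "f = ?z"
      using f by metis
    then show ?thesis by simp
  qed
  note ind = independent_Union_direct_sum[OF vector_space_axioms fin uniq B]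
  have "v \<in> span (\<Union>x\<in>carrier G. B x)" for v
  proof -
    obtain f where f: "f \<in> (\<Pi>\<^sub>E x\<in>carrier G. hom_comp V x)" "v = (\<Sum>x\<in>carrier G. f x)"
      using dec[of v] by blast
    have "f x \<in> span (\<Union>x\<in>carrier G. B x)" if "x \<in> carrier G" for x
    proof -
      have "f x \<in> span (B x)"
        using f(1) that B(3) by auto
      then show ?thesis
        using span_mono[of "B x" "\<Union>x\<in>carrier G. B x"] that by blast
    qed
    then show ?thesis
      unfolding f(2) by (rule span_sum)
  qed
  then show ?thesis
    using that[OF B(1,3,2) ind] by blast
qed

text \<open>The matrix coefficient at \<open>b \<otimes> c\<close> contains the \<open>c\<close>-coordinate of a vector of degree \<open>x \<triangleright> y\<close>.  It
  vanishes unless \<open>x \<triangleright> y = y\<close>, and then both factors are coordinates within single components.\<close>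

lemma S_matrix_eq_sum_commuting:
  fixes G (structure) and V :: "('g, 'v::ab_group_add) graded_rep" and W :: "('g, 'w::ab_group_add) graded_rep"
  assumes G: "group G" and fin: "finite (carrier G)"
    and V: "center_object G \<omega> V" and W: "center_object G \<omega> W"
  shows "S_matrix G V W = (\<Sum>x\<in>carrier G. \<Sum>y\<in>{y \<in> carrier G. x \<otimes> y = y \<otimes> x}.
    comp_char V x y * comp_char W y x)"
proof -
  interpret group G by fact
  interpret V: vector_space "scl V"
    using V by (simp add: center_object_def)
  interpret W: vector_space "scl W"
    using W by (simp add: center_object_def)
  obtain B where B: "\<And>x. x \<in> carrier G \<Longrightarrow> finite (B x)"
    "\<And>x. x \<in> carrier G \<Longrightarrow> V.span (B x) = hom_comp V x"
    "\<And>x. x \<in> carrier G \<Longrightarrow> V.independent (B x)"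
    "\<And>x y. x \<in> carrier G \<Longrightarrow> y \<in> carrier G \<Longrightarrow> x \<noteq> y \<Longrightarrow> B x \<inter> B y = {}"
    "V.independent (\<Union>x\<in>carrier G. B x)" "V.span (\<Union>x\<in>carrier G. B x) = UNIV"
    using homogeneous_basis[OF fin V] by blast
  obtain C where C: "\<And>x. x \<in> carrier G \<Longrightarrow> finite (C x)"
    "\<And>x. x \<in> carrier G \<Longrightarrow> W.span (C x) = hom_comp W x"
    "\<And>x. x \<in> carrier G \<Longrightarrow> W.independent (C x)"
    "\<And>x y. x \<in> carrier G \<Longrightarrow> y \<in> carrier G \<Longrightarrow> x \<noteq> y \<Longrightarrow> C x \<inter> C y = {}"
    "W.independent (\<Union>x\<in>carrier G. C x)" "W.span (\<Union>x\<in>carrier G. C x) = UNIV"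
    using homogeneous_basis[OF fin W] by blast
  let ?B = "\<Union>x\<in>carrier G. B x" and ?C = "\<Union>x\<in>carrier G. C x"
  define degB where "degB b = (THE x. x \<in> carrier G \<and> b \<in> B x)" for b
  define degC where "degC c = (THE x. x \<in> carrier G \<and> c \<in> C x)" for c
  have degB: "degB b = x" if "x \<in> carrier G" "b \<in> B x" for b x
    unfolding degB_def using that B(4) by (intro the_equality) blast+
  have degC: "degC c = x" if "x \<in> carrier G" "c \<in> C x" for c x
    unfolding degC_def using that C(4) by (intro the_equality) blast+
  let ?F = "braiding G W V \<circ> braiding G V W"
  let ?f = "\<lambda>b c. act V (degB b \<triangleright> degC c) b" and ?k = "\<lambda>b c. act W (degB b) c"
  have BV: "b \<in> hom_comp V x" if "x \<in> carrier G" "b \<in> B x" for x b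
    using B(2)[OF that(1)] V.span_base[OF that(2)] by simp
  have CW: "c \<in> hom_comp W x" if "x \<in> carrier G" "c \<in> C x" for x c
    using C(2)[OF that(1)] W.span_base[OF that(2)] by simp
  have double_braiding: "?F (tensor (scl V) (scl W) b c) = tensor (scl V) (scl W) (?f b c) (?k b c)"
    if bc: "b \<in> ?B" "c \<in> ?C" for b c
  proof -
    obtain x y where xy: "x \<in> carrier G" "b \<in> B x" "y \<in> carrier G" "c \<in> C y"
      using bc by blast
    have "?F (tensor (scl V) (scl W) b c) = braiding G W V (tensor (scl W) (scl V) (act W x c) b)"
      using braiding(2)[OF fin V W xy(1) BV[OF xy(1,2)], of c] by (simp only: o_def)
    also have "\<dots> = tensor (scl V) (scl W) (act V (x \<triangleright> y) b) (act W x c)"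
      by (rule braiding(2)[OF fin W V conjugate_closed[OF xy(1,3)] act_in_hom_comp[OF W xy(1,3) CW[OF xy(3,4)]]])
    finally show ?thesis
      by (simp only: degB[OF xy(1,2)] degC[OF xy(3,4)])
  qed
  let ?T = "\<lambda>b c. V.representation ?B (?f b c) b * W.representation ?C (?k b c) c"
  have finB: "finite ?B" and finC: "finite ?C"
    using fin B(1) C(1) by blast+
  have "S_matrix G V W = (\<Sum>b\<in>?B. \<Sum>c\<in>?C. ?T b c)"
    unfolding S_matrix_def
  proof (rule trace_on_tensor_space[OF V.vector_space_axioms W.vector_space_axioms
        finB B(5,6) finC C(5,6), where f = ?f and k = ?k])
    show "Vector_Spaces.linear tensor_scale tensor_scale ?F"
      by (rule Vector_Spaces.linear_compose) (rule braiding(1)[OF fin V W] braiding(1)[OF fin W V])+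
  qed (rule double_braiding)
  also have "\<dots> = (\<Sum>x\<in>carrier G. \<Sum>b\<in>B x. \<Sum>y\<in>carrier G. \<Sum>c\<in>C y. ?T b c)"
    using fin B(1,4) C(1,4) by (simp add: sum.UNION_disjoint)
  also have "\<dots> = (\<Sum>x\<in>carrier G. \<Sum>y\<in>carrier G. \<Sum>b\<in>B x. \<Sum>c\<in>C y. ?T b c)"
    by (intro sum.cong refl sum.swap)
  also have "\<dots> = (\<Sum>x\<in>carrier G. \<Sum>y\<in>carrier G.
      if x \<otimes> y = y \<otimes> x then comp_char V x y * comp_char W y x else 0)"
  proof (intro sum.cong refl)
    fix x y assume x: "x \<in> carrier G" and y: "y \<in> carrier G"
    have T: "?T b c = V.representation ?B (act V (x \<triangleright> y) b) b * W.representation (C (x \<triangleright> y)) (act W x c) c"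
      if "b \<in> B x" "c \<in> C y" for b c
    proof -
      have "act W x c \<in> W.span (C (x \<triangleright> y))"
        using act_in_hom_comp[OF W x y CW[OF y that(2)]] C(2) x y by simp
      then have "W.representation ?C (act W x c) = W.representation (C (x \<triangleright> y)) (act W x c)"
        using conjugate_closed[OF x y] by (intro W.representation_extend[OF C(5)]) blast+
      then show ?thesis
        by (simp add: degB[OF x that(1)] degC[OF y that(2)])
    qed
    show "(\<Sum>b\<in>B x. \<Sum>c\<in>C y. ?T b c)
        = (if x \<otimes> y = y \<otimes> x then comp_char V x y * comp_char W y x else 0)"
    proof (cases "x \<otimes> y = y \<otimes> x")
      case True
      then have fixed: "x \<triangleright> y = y" "y \<triangleright> x = x"
        using x y by (simp_all add: conjugate_eq_iff_mult)
      have inv: "act V y ` hom_comp V x \<subseteq> hom_comp V x" "act W x ` hom_comp W y \<subseteq> hom_comp W y"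
        using act_in_hom_comp[OF V y x] act_in_hom_comp[OF W x y] fixed by auto
      have lin: "Vector_Spaces.linear (scl V) (scl V) (act V y)"
        "Vector_Spaces.linear (scl W) (scl W) (act W x)"
        using V W x y by (simp_all add: center_object_def)
      have "V.representation ?B (act V y b) b = V.representation (B x) (act V y b) b" if "b \<in> B x" for b
      proof -
        have "act V y b \<in> V.span (B x)"
          using inv(1) BV[OF x that] B(2)[OF x] by auto
        then show ?thesis
          using x by (subst V.representation_extend[OF B(5), of _ "B x"]) auto
      qed
      then have "(\<Sum>b\<in>B x. \<Sum>c\<in>C y. ?T b c)
          = (\<Sum>b\<in>B x. V.representation (B x) (act V y b) b) * (\<Sum>c\<in>C y. W.representation (C y) (act W x c) c)"
        by (simp add: T fixed sum_product)
      also have "\<dots> = comp_char V x y * comp_char W y x"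
        unfolding comp_char_def
        using trace_on_eq[OF lin(1) B(1,3,2)[OF x] inv(1)] trace_on_eq[OF lin(2) C(1,3,2)[OF y] inv(2)]
        by simp
      finally show ?thesis
        using True by simp
    next
      case False
      then have "x \<triangleright> y \<noteq> y"
        using x y by (simp add: conjugate_eq_iff_mult)
      then have "c \<notin> C (x \<triangleright> y)" if "c \<in> C y" for c
        using C(4)[of "x \<triangleright> y" y] x y that by auto
      then have "W.representation (C (x \<triangleright> y)) w c = 0" if "c \<in> C y" for w c
        using that W.representation_ne_zero by blast
      then show ?thesis
        using False by (simp add: T)
    qed
  qed
  finally show ?thesis
    using fin by (simp add: sum.inter_filter)
qed

section \<open>The S-matrix\<close>

lemma comp_char_eq_0:
  assumes V: "center_object G \<omega> V" and c: "c \<in> carrier G"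
    and x: "x \<in> carrier G" "x \<notin> support G V"
  shows "comp_char V x c = 0"
  using assms by (simp add: comp_char_def support_def center_object_def trace_on_zero)

lemma sum_conj_class_eq_sum_carrier:
  fixes G (structure) and t :: "'a \<Rightarrow> complex"
  assumes G: "group G" and fin: "finite (carrier G)" and g: "g \<in> carrier G"
  shows "(\<Sum>x\<in>{x \<in> conj_class G g. Q x}. t x) =
    (\<Sum>p\<in>{p \<in> carrier G. Q (p \<triangleright> g)}. t (p \<triangleright> g)) / of_nat (card (centralizer G g))"
proof -
  interpret group G by fact
  let ?P = "{p \<in> carrier G. Q (p \<triangleright> g)}"
  have "finite (centralizer G g)" "\<one> \<in> centralizer G g"
    using fin g by (simp_all add: centralizer_def)
  then have C: "card (centralizer G g) \<noteq> 0"
    by auto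
  have image: "(\<lambda>p. p \<triangleright> g) ` ?P = {x \<in> conj_class G g. Q x}"
    by (auto simp: conj_class_def)
  have "(\<Sum>p\<in>?P. t (p \<triangleright> g)) =
      (\<Sum>x\<in>{x \<in> conj_class G g. Q x}. \<Sum>p\<in>{p \<in> ?P. p \<triangleright> g = x}. t (p \<triangleright> g))"
    using sum.image_gen[of ?P "\<lambda>p. t (p \<triangleright> g)" "\<lambda>p. p \<triangleright> g"] fin by (simp add: image)
  also have "\<dots> = (\<Sum>x\<in>{x \<in> conj_class G g. Q x}. of_nat (card (centralizer G g)) * t x)"
  proof (rule sum.cong[OF refl])
    fix x assume x: "x \<in> {x \<in> conj_class G g. Q x}"
    then have "{p \<in> ?P. p \<triangleright> g = x} = {p \<in> carrier G. p \<triangleright> g = x}"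
      by auto
    then show "(\<Sum>p\<in>{p \<in> ?P. p \<triangleright> g = x}. t (p \<triangleright> g)) = of_nat (card (centralizer G g)) * t x"
      using card_conjugate_fibre[OF g, of x] x by simp
  qed
  finally show ?thesis
    using C by (simp add: sum_distrib_left[symmetric])
qed

text \<open>Components outside the supports have trace \<open>0\<close>, which cuts the sum over commuting pairs down to the
  two classes; conjugating by \<open>p\<close> then moves the inner sum at \<open>y = p \<triangleright> h\<close> to the one at \<open>h\<close>.\<close>

lemma S_matrix_eq_sum_conj_class:
  fixes G (structure) and V :: "('g, 'v::ab_group_add) graded_rep"
    and W :: "('g, 'w::ab_group_add) graded_rep"
  assumes G: "group G" and fin: "finite (carrier G)" and \<omega>: "normalized_3_cocycle G \<omega>"
    and V: "center_object G \<omega> V" and W: "center_object G \<omega> W"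
    and g: "g \<in> carrier G" "support G V = conj_class G g"
    and h: "h \<in> carrier G" "support G W = conj_class G h"
  shows "S_matrix G V W = of_nat (card (conj_class G h)) *
    (\<Sum>x\<in>{x \<in> conj_class G g. commutator G x h = \<one>}. comp_char V x h * comp_char W h x)"
proof -
  interpret group G by fact
  let ?R = "\<lambda>x y. comp_char V x y * comp_char W y x"
  let ?X = "\<lambda>y. {x \<in> conj_class G g. x \<otimes> y = y \<otimes> x}"
  have "S_matrix G V W = (\<Sum>x\<in>carrier G. \<Sum>y\<in>{y \<in> carrier G. x \<otimes> y = y \<otimes> x}. ?R x y)"
    by (rule S_matrix_eq_sum_commuting[OF G fin V W])
  also have "\<dots> = (\<Sum>y\<in>carrier G. \<Sum>x\<in>{x \<in> carrier G. x \<otimes> y = y \<otimes> x}. ?R x y)"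
    by (rule sum.swap_restrict[OF fin fin])
  also have "\<dots> = (\<Sum>y\<in>conj_class G h. \<Sum>x\<in>?X y. ?R x y)"
  proof (rule sum.mono_neutral_cong_right[OF fin conj_class_closed[OF h(1)]])
    show "\<forall>y\<in>carrier G - conj_class G h. (\<Sum>x\<in>{x \<in> carrier G. x \<otimes> y = y \<otimes> x}. ?R x y) = 0"
      by (intro ballI sum.neutral) (simp add: comp_char_eq_0[OF W] h(2))
    show "(\<Sum>x\<in>{x \<in> carrier G. x \<otimes> y = y \<otimes> x}. ?R x y) = (\<Sum>x\<in>?X y. ?R x y)"
      if y: "y \<in> conj_class G h" for y
    proof (rule sum.mono_neutral_right)
      have "comp_char V x y = 0" if "x \<in> carrier G" "x \<notin> conj_class G g" for x
        using comp_char_eq_0[OF V _ that(1)] that g(2) conj_class_closed[OF h(1)] y by auto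
      then show "\<forall>x\<in>{x \<in> carrier G. x \<otimes> y = y \<otimes> x} - ?X y. ?R x y = 0"
        by auto
    qed (use fin conj_class_closed[OF g(1)] in auto)
  qed
  also have "\<dots> = (\<Sum>y\<in>conj_class G h. \<Sum>x\<in>?X h. ?R x h)"
  proof (rule sum.cong[OF refl])
    fix y assume "y \<in> conj_class G h"
    then obtain p where p: "p \<in> carrier G" "y = p \<triangleright> h"
      by (auto simp: conj_class_def)
    have closed: "x \<in> carrier G" if "x \<in> conj_class G g" for x
      using that conj_class_closed[OF g(1)] by blast
    show "(\<Sum>x\<in>?X y. ?R x y) = (\<Sum>x\<in>?X h. ?R x h)"
    proof (rule sum.reindex_bij_witness[where i = "\<lambda>x. p \<triangleright> x" and j = "\<lambda>x. inv p \<triangleright> x"])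
      fix x assume x: "x \<in> ?X h"
      then show "inv p \<triangleright> (p \<triangleright> x) = x" "p \<triangleright> x \<in> ?X y"
        using p g(1) h(1) closed by (simp_all add: conjugate_in_conj_class_iff conjugate_commute_iff)
    next
      fix x assume x: "x \<in> ?X y"
      then have x': "x \<in> carrier G" "inv p \<triangleright> x \<in> carrier G" using closed p(1) by auto
      show px: "p \<triangleright> (inv p \<triangleright> x) = x"
        using x' p(1) by simp
      have comm: "(inv p \<triangleright> x) \<otimes> h = h \<otimes> (inv p \<triangleright> x)"
        using conjugate_commute_iff[OF p(1) x'(2) h(1)] x p(2) px by simp
      then show "inv p \<triangleright> x \<in> ?X h"
        using x x' p g(1) by (simp add: conjugate_in_conj_class_iff)
      show "?R (inv p \<triangleright> x) h = ?R x y"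
        using comp_char_mult_conjugate[OF G \<omega> V W p(1) x'(2) h(1) comm] p(2) px by simp
    qed
  qed
  also have "?X h = {x \<in> conj_class G g. commutator G x h = \<one>}"
    using conj_class_closed[OF g(1)] h(1) by (auto simp: commutator_eq_one_iff subset_iff)
  finally show ?thesis
    by simp
qed

theorem mainTheorem3:
  fixes G :: "('g, 'm) monoid_scheme"
    and \<omega> :: "'g \<Rightarrow> 'g \<Rightarrow> 'g \<Rightarrow> complex"
    and V :: "('g, 'v::ab_group_add) graded_rep"
    and W :: "('g, 'w::ab_group_add) graded_rep"
    and g h :: 'g
    and \<chi>\<^sub>1 \<chi>\<^sub>2 :: "'g \<Rightarrow> complex"
  assumes "group G" and "finite (carrier G)"
    and "normalized_3_cocycle G \<omega>"
    and "simple_object G \<omega> V" and "corresponds_to G V g \<chi>\<^sub>1"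
    and "simple_object G \<omega> W" and "corresponds_to G W h \<chi>\<^sub>2"
  shows "S_matrix G V W =
           of_nat (card (conj_class G h)) *
             (\<Sum>x\<in>{x \<in> conj_class G g. commutator G x h = \<one>\<^bsub>G\<^esub>}. comp_char V x h * \<chi>\<^sub>2 x)
       \<and> of_nat (card (conj_class G h)) *
             (\<Sum>x\<in>{x \<in> conj_class G g. commutator G x h = \<one>\<^bsub>G\<^esub>}. comp_char V x h * \<chi>\<^sub>2 x) =
           of_nat (card (conj_class G h)) / of_nat (card (centralizer G g)) *
             (\<Sum>p\<in>{p \<in> carrier G. commutator G (p \<triangleright>\<^bsub>G\<^esub> g) h = \<one>\<^bsub>G\<^esub>}.
                proj_cocycle G \<omega> g h p
                * inverse (proj_cocycle G \<omega> g p (inv\<^bsub>G\<^esub> p \<triangleright>\<^bsub>G\<^esub> h))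
                * \<chi>\<^sub>1 (inv\<^bsub>G\<^esub> p \<triangleright>\<^bsub>G\<^esub> h)
                * \<chi>\<^sub>2 (p \<triangleright>\<^bsub>G\<^esub> g))"
proof -
  interpret group G by fact
  note \<omega> = \<open>normalized_3_cocycle G \<omega>\<close>
  have V: "center_object G \<omega> V" and W: "center_object G \<omega> W"
    using assms(4,6) by (simp_all add: simple_object_def)
  have g: "g \<in> carrier G" "support G V = conj_class G g"
    and \<chi>\<^sub>1: "\<And>c. c \<in> centralizer G g \<Longrightarrow> \<chi>\<^sub>1 c = comp_char V g c"
    and h: "h \<in> carrier G" "support G W = conj_class G h"
    and \<chi>\<^sub>2: "\<And>c. c \<in> centralizer G h \<Longrightarrow> \<chi>\<^sub>2 c = comp_char W h c"
    using assms(5,7) by (simp_all add: corresponds_to_def)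
  let ?X = "{x \<in> conj_class G g. commutator G x h = \<one>\<^bsub>G\<^esub>}"
  let ?P = "{p \<in> carrier G. commutator G (p \<triangleright>\<^bsub>G\<^esub> g) h = \<one>\<^bsub>G\<^esub>}"
  have "S_matrix G V W = of_nat (card (conj_class G h)) * (\<Sum>x\<in>?X. comp_char V x h * comp_char W h x)"
    by (rule S_matrix_eq_sum_conj_class[OF assms(1,2) \<omega> V W g h])
  also have "(\<Sum>x\<in>?X. comp_char V x h * comp_char W h x) = (\<Sum>x\<in>?X. comp_char V x h * \<chi>\<^sub>2 x)"
  proof (rule sum.cong[OF refl])
    fix x assume "x \<in> ?X"
    then have "x \<in> centralizer G h"
      using conj_class_closed[OF g(1)] h(1) by (auto simp: commutator_eq_one_iff centralizer_def)
    then show "comp_char V x h * comp_char W h x = comp_char V x h * \<chi>\<^sub>2 x"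
      by (simp add: \<chi>\<^sub>2)
  qed
  finally have first: "S_matrix G V W =
    of_nat (card (conj_class G h)) * (\<Sum>x\<in>?X. comp_char V x h * \<chi>\<^sub>2 x)" .
  have char: "comp_char V (p \<triangleright>\<^bsub>G\<^esub> g) h =
      proj_cocycle G \<omega> g h p * inverse (proj_cocycle G \<omega> g p (inv\<^bsub>G\<^esub> p \<triangleright>\<^bsub>G\<^esub> h))
      * \<chi>\<^sub>1 (inv\<^bsub>G\<^esub> p \<triangleright>\<^bsub>G\<^esub> h)" if "p \<in> ?P" for p
  proof -
    let ?y = "inv\<^bsub>G\<^esub> p \<triangleright>\<^bsub>G\<^esub> h"
    have p: "p \<in> carrier G" "?y \<in> carrier G" "p \<triangleright>\<^bsub>G\<^esub> ?y = h"
      using that h(1) by simp_all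
    have comm: "g \<otimes>\<^bsub>G\<^esub> ?y = ?y \<otimes>\<^bsub>G\<^esub> g"
      using conjugate_commute_iff[OF p(1) g(1) p(2)] that h(1) p g(1)
      by (simp add: commutator_eq_one_iff)
    then have "?y \<in> centralizer G g"
      using p(2) by (simp add: centralizer_def)
    then show ?thesis
      using comp_char_conjugate[OF assms(1) \<omega> V p(1) g(1) p(2) comm] by (simp add: p(3) \<chi>\<^sub>1)
  qed
  have "(\<Sum>x\<in>?X. comp_char V x h * \<chi>\<^sub>2 x)
      = (\<Sum>p\<in>?P. comp_char V (p \<triangleright>\<^bsub>G\<^esub> g) h * \<chi>\<^sub>2 (p \<triangleright>\<^bsub>G\<^esub> g)) / of_nat (card (centralizer G g))"
    by (rule sum_conj_class_eq_sum_carrier[OF assms(1,2) g(1)])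
  then show ?thesis
    using first by (simp add: char)
qed

end
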